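(* Let $\mathbb{X}$ and $\mathbb{Y}$ be quasi-Banach spaces, $T\in\mathcal{L}(\mathbb{X},\mathbb{Y})$ and $n\in\mathbb{N}$. Then $$d_{n}(T)\leq a_{n}(T).$$
   Context: Vector spaces are over $\mathbb{K}=\mathbb{R}$ or $\mathbb{C}$. A quasi-norm with constant $C\geq1$ on a vector space $\mathbb{X}$ is a map $\Vert\cdot\Vert:\mathbb{X}\to[0,\infty)$ with $\Vert x\Vert=0\iff x=0$, $\Vert\lambda x\Vert=|\lambda|\Vert x\Vert$, and $\Vert x+y\Vert\leq C(\Vert x\Vert+\Vert y\Vert)$. A quasi-Banach space is a complete quasi-normed space. $\mathcal{L}(\mathbb{X},\mathbb{Y})$ is the space of bounded linear operators, with $\Vert T\Vert=\sup_{\Vert x\Vert_{\mathbb{X}}\leq1}\Vert Tx\Vert_{\mathbb{Y}}$; $\operatorname{rank}S$ is the dimension of the range of $S$. For $n\in\mathbb{N}=\{1,2,\ldots\}$ the $n$-th approximation number of $T\in\mathcal{L}(\mathbb{X},\mathbb{Y})$ is $$a_{n}(T):=\inf\{\Vert T-S\Vert:\ S\in\mathcal{L}(\mathbb{X},\mathbb{Y}),\ \operatorname{rank}S<n\},$$ and the $n$-th Kolmogorov number is $$d_{n}(T):=\inf_{U_{n}\subset\mathbb{Y},\ \dim U_{n}<n}\ \sup_{\Vert x\Vert_{\mathbb{X}}\leq1}\ \inf_{y\in U_{n}}\Vert Tx-y\Vert_{\mathbb{Y}},$$ where the outer infimum is over linear subspaces $U_n$ of $\mathbb{Y}$. *)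

theory Defs
  imports Complex_Main
begin

text \<open>
  The scalars range over an arbitrary type of class \<open>real_normed_field\<close>. Besides the
  instances \<open>real\<close> and \<open>complex\<close> this class has, up to isomorphism, no further ones
  (Gelfand--Mazur; its norm is multiplicative), so the scalar field is the real or the complex
  numbers with the usual absolute value.
  The library's normed vector spaces require the triangle inequality with constant 1, so a
  quasi-normed space is a vector space together with an explicit quasi-norm.
\<close>

locale quasi_normed_space = vector_space scale
  for scale :: "'k::real_normed_field \<Rightarrow> 'a::ab_group_add \<Rightarrow> 'a" +
  fixes qnorm :: "'a \<Rightarrow> real" and C :: real
  assumes const_ge_1: "1 \<le> C"
    and qnorm_nonneg: "0 \<le> qnorm x"
    and qnorm_eq_0_iff: "qnorm x = 0 \<longleftrightarrow> x = 0"
    and qnorm_scale: "qnorm (scale c x) = norm c * qnorm x"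
    and qnorm_triangle: "qnorm (x + y) \<le> C * (qnorm x + qnorm y)"

definition qnorm_Cauchy :: "('a::ab_group_add \<Rightarrow> real) \<Rightarrow> (nat \<Rightarrow> 'a) \<Rightarrow> bool" where
  "qnorm_Cauchy qnorm X \<longleftrightarrow> (\<forall>e>0. \<exists>N. \<forall>i\<ge>N. \<forall>j\<ge>N. qnorm (X i - X j) < e)"

locale quasi_banach_space = quasi_normed_space scale qnorm C
  for scale :: "'k::real_normed_field \<Rightarrow> 'a::ab_group_add \<Rightarrow> 'a"
    and qnorm :: "'a \<Rightarrow> real" and C :: real +
  assumes complete: "qnorm_Cauchy qnorm X \<Longrightarrow> \<exists>x. (\<lambda>i. qnorm (X i - x)) \<longlonglongrightarrow> 0"

definition bounded_operators ::
    "('k::real_normed_field \<Rightarrow> 'a::ab_group_add \<Rightarrow> 'a) \<Rightarrow> ('a \<Rightarrow> real) \<Rightarrow>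
     ('k \<Rightarrow> 'b::ab_group_add \<Rightarrow> 'b) \<Rightarrow> ('b \<Rightarrow> real) \<Rightarrow> ('a \<Rightarrow> 'b) set" where
  "bounded_operators sX qX sY qY =
     {T. Vector_Spaces.linear sX sY T \<and> (\<exists>M. \<forall>x. qY (T x) \<le> M * qX x)}"

text \<open>
  The suprema and infima below are taken in \<^typ>\<open>real\<close>. For bounded operators and \<open>n \<ge> 1\<close>
  all the sets involved are nonempty and bounded on the relevant side.
\<close>

definition operator_qnorm ::
    "('a \<Rightarrow> real) \<Rightarrow> ('b \<Rightarrow> real) \<Rightarrow> ('a \<Rightarrow> 'b) \<Rightarrow> real" where
  "operator_qnorm qX qY T = (SUP x\<in>{x. qX x \<le> 1}. qY (T x))"

text \<open>
  The library's \<open>dim\<close> is 0 on infinite-dimensional sets, so finite-dimensionality has to be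
  required separately.
\<close>

definition dim_less ::
    "('k::field \<Rightarrow> 'a::ab_group_add \<Rightarrow> 'a) \<Rightarrow> 'a set \<Rightarrow> nat \<Rightarrow> bool" where
  "dim_less scale U n \<longleftrightarrow>
     (\<exists>B. finite B \<and> U \<subseteq> module.span scale B) \<and> vector_space.dim scale U < n"

definition approximation_number ::
    "('k::real_normed_field \<Rightarrow> 'a::ab_group_add \<Rightarrow> 'a) \<Rightarrow> ('a \<Rightarrow> real) \<Rightarrow>
     ('k \<Rightarrow> 'b::ab_group_add \<Rightarrow> 'b) \<Rightarrow> ('b \<Rightarrow> real) \<Rightarrow> nat \<Rightarrow> ('a \<Rightarrow> 'b) \<Rightarrow> real" where
  "approximation_number sX qX sY qY n T =
     (INF S\<in>{S \<in> bounded_operators sX qX sY qY. dim_less sY (range S) n}.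
        operator_qnorm qX qY (\<lambda>x. T x - S x))"

definition kolmogorov_number ::
    "('a \<Rightarrow> real) \<Rightarrow> ('k::real_normed_field \<Rightarrow> 'b::ab_group_add \<Rightarrow> 'b) \<Rightarrow> ('b \<Rightarrow> real) \<Rightarrow>
     nat \<Rightarrow> ('a \<Rightarrow> 'b) \<Rightarrow> real" where
  "kolmogorov_number qX sY qY n T =
     (INF U\<in>{U. module.subspace sY U \<and> dim_less sY U n}.
        SUP x\<in>{x. qX x \<le> 1}. INF y\<in>U. qY (T x - y))"

end

theory Submission
  imports Defs
begin

text \<open>
  An operator \<open>S\<close> of rank less than \<open>n\<close> supplies the subspace \<open>range S\<close>, which competes in
  the infimum defining the Kolmogorov number. For \<open>x\<close> in the unit ball the point \<open>S x\<close> lies in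
  this subspace, so the distance from \<open>T x\<close> to it is at most the quasi-norm of \<open>T x - S x\<close>, hence
  at most the operator quasi-norm of \<open>T - S\<close> (\<open>deviation_range_le_operator_qnorm\<close>). Taking the
  infimum over \<open>S\<close> gives the inequality.

  In the reals this argument needs every supremum and infimum to be a genuine one: the
  distances are infima of nonnegative numbers, and the suprema over the unit ball are bounded
  because \<open>T\<close> and \<open>T - S\<close> are bounded there, the latter by the quasi-triangle inequality. The zero
  operator has rank less than \<open>n\<close> because \<open>n \<ge> 1\<close>, so the infimum over \<open>S\<close> is over a nonempty
  set.
\<close>

context quasi_normed_space
begin

lemma qnorm_zero: "qnorm 0 = 0"
  using qnorm_eq_0_iff by blast

lemma qnorm_minus: "qnorm (- x) = qnorm x"
  using qnorm_scale[of "- 1" x] by simp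

lemma qnorm_diff_le: "qnorm (x - y) \<le> C * (qnorm x + qnorm y)"
  using qnorm_triangle[of x "- y"] by (simp add: qnorm_minus)

lemma bdd_below_qnorm_image: "bdd_below ((\<lambda>y. qnorm (f y)) ` U)"
  by (rule bdd_belowI2[of _ 0]) (rule qnorm_nonneg)

lemma distance_le: "y \<in> U \<Longrightarrow> (INF y\<in>U. qnorm (z - y)) \<le> qnorm (z - y)"
  by (rule cINF_lower[OF bdd_below_qnorm_image])

lemma distance_nonneg: "U \<noteq> {} \<Longrightarrow> 0 \<le> (INF y\<in>U. qnorm (z - y))"
  by (rule cINF_greatest) (auto simp: qnorm_nonneg)

text \<open>
  This makes the infimum in the Kolmogorov number bounded below. The bound \<open>M\<close> is there because
  an unbounded set of reals has an unspecified supremum; the distances inherit \<open>M\<close> through the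
  competitor \<open>0 \<in> U\<close>.
\<close>
lemma sup_distance_nonneg:
  assumes "A \<noteq> {}" and "0 \<in> U" and bound: "\<And>x. x \<in> A \<Longrightarrow> qnorm (f x) \<le> M"
  shows "0 \<le> (SUP x\<in>A. INF y\<in>U. qnorm (f x - y))"
proof -
  obtain a where "a \<in> A" using \<open>A \<noteq> {}\<close> by blast
  have "(INF y\<in>U. qnorm (f x - y)) \<le> M" if "x \<in> A" for x
    using distance_le[OF \<open>0 \<in> U\<close>, of "f x"] bound[OF that] by simp
  then have "bdd_above ((\<lambda>x. INF y\<in>U. qnorm (f x - y)) ` A)"
    by (rule bdd_aboveI2)
  then have "(INF y\<in>U. qnorm (f a - y)) \<le> (SUP x\<in>A. INF y\<in>U. qnorm (f x - y))"
    by (rule cSUP_upper[OF \<open>a \<in> A\<close>])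
  moreover have "0 \<le> (INF y\<in>U. qnorm (f a - y))"
    using \<open>0 \<in> U\<close> by (intro distance_nonneg) blast
  ultimately show ?thesis by linarith
qed

end

lemma bounded_operators_linear:
  "T \<in> bounded_operators sX qX sY qY \<Longrightarrow> Vector_Spaces.linear sX sY T"
  by (simp add: bounded_operators_def)

lemma bounded_operator_unit_ball_bound:
  assumes "quasi_normed_space sX qX CX"
    and "T \<in> bounded_operators sX qX sY qY"
  obtains M where "\<And>x. qX x \<le> 1 \<Longrightarrow> qY (T x) \<le> M"
proof -
  interpret X: quasi_normed_space sX qX CX by fact
  obtain M where M: "\<And>x. qY (T x) \<le> M * qX x"
    using assms(2) by (auto simp: bounded_operators_def)
  have "qY (T x) \<le> \<bar>M\<bar>" if "qX x \<le> 1" for x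
  proof -
    have "M * qX x \<le> \<bar>M\<bar> * 1"
      using that by (intro mult_mono) (auto simp: X.qnorm_nonneg)
    then show ?thesis using M[of x] by simp
  qed
  then show thesis by (rule that)
qed

text \<open>
  The operator quasi-norm of a difference is a finite supremum, so it dominates each value on
  the unit ball.
\<close>
lemma operator_qnorm_diff_upper:
  assumes "quasi_normed_space sX qX CX"
    and "quasi_normed_space sY qY CY"
    and T: "T \<in> bounded_operators sX qX sY qY"
    and S: "S \<in> bounded_operators sX qX sY qY"
    and "qX x \<le> 1"
  shows "qY (T x - S x) \<le> operator_qnorm qX qY (\<lambda>x. T x - S x)"
proof -
  interpret Y: quasi_normed_space sY qY CY by fact
  obtain M where M: "\<And>x. qX x \<le> 1 \<Longrightarrow> qY (T x) \<le> M"
    using bounded_operator_unit_ball_bound[OF assms(1) T] by blast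
  obtain N where N: "\<And>x. qX x \<le> 1 \<Longrightarrow> qY (S x) \<le> N"
    using bounded_operator_unit_ball_bound[OF assms(1) S] by blast
  have "qY (T z - S z) \<le> CY * (M + N)" if "qX z \<le> 1" for z
  proof -
    have "CY * (qY (T z) + qY (S z)) \<le> CY * (M + N)"
      using M[OF that] N[OF that] Y.const_ge_1 by (intro mult_left_mono) auto
    then show ?thesis using Y.qnorm_diff_le[of "T z" "S z"] by linarith
  qed
  then have "bdd_above ((\<lambda>x. qY (T x - S x)) ` {x. qX x \<le> 1})"
    by (intro bdd_aboveI2) auto
  then show ?thesis
    unfolding operator_qnorm_def using \<open>qX x \<le> 1\<close> by (intro cSUP_upper) auto
qed

text \<open>
  The operator \<open>S\<close> itself selects a nearby point \<open>S x\<close> of its range for each \<open>T x\<close>; the range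
  can only do better than this linear selection.
\<close>
lemma deviation_range_le_operator_qnorm:
  assumes X: "quasi_normed_space sX qX CX"
    and Y: "quasi_normed_space sY qY CY"
    and T: "T \<in> bounded_operators sX qX sY qY"
    and S: "S \<in> bounded_operators sX qX sY qY"
  shows "(SUP x\<in>{x. qX x \<le> 1}. INF y\<in>range S. qY (T x - y))
           \<le> operator_qnorm qX qY (\<lambda>x. T x - S x)"
proof (rule cSUP_least)
  interpret X: quasi_normed_space sX qX CX by fact
  have "0 \<in> {x. qX x \<le> 1}" by (simp add: X.qnorm_zero)
  then show "{x. qX x \<le> 1} \<noteq> {}" by blast
next
  interpret Y: quasi_normed_space sY qY CY by fact
  fix x assume "x \<in> {x. qX x \<le> 1}"
  then have "qY (T x - S x) \<le> operator_qnorm qX qY (\<lambda>x. T x - S x)"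
    using operator_qnorm_diff_upper[OF X Y T S] by blast
  moreover have "(INF y\<in>range S. qY (T x - y)) \<le> qY (T x - S x)"
    by (rule Y.distance_le) simp
  ultimately show "(INF y\<in>range S. qY (T x - y)) \<le> operator_qnorm qX qY (\<lambda>x. T x - S x)"
    by linarith
qed

lemma zero_operator_bounded:
  assumes "quasi_normed_space sX qX CX" and "quasi_normed_space sY qY CY"
  shows "(\<lambda>x. 0) \<in> bounded_operators sX qX sY qY"
proof -
  interpret X: quasi_normed_space sX qX CX by fact
  interpret Y: quasi_normed_space sY qY CY by fact
  interpret vector_space_pair sX sY ..
  have "\<forall>x. qY 0 \<le> 0 * qX x" by (simp add: Y.qnorm_zero)
  then show ?thesis
    unfolding bounded_operators_def using linear_zero by blast
qed

lemma dim_less_zero_subspace: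
  fixes sY :: "'k::field \<Rightarrow> 'b::ab_group_add \<Rightarrow> 'b"
  assumes "vector_space sY" and "n \<ge> 1"
  shows "dim_less sY {0} n"
proof -
  interpret Y: vector_space sY by fact
  have span: "{0} \<subseteq> Y.span {}" by simp
  have "Y.dim {0} \<le> card ({} :: 'b set)"
    by (rule Y.dim_le_card[OF span]) simp
  then have "Y.dim {0} < n" using \<open>n \<ge> 1\<close> by simp
  then show ?thesis
    unfolding dim_less_def using span finite.emptyI by blast
qed

lemma bounded_operator_range_subspace:
  assumes "S \<in> bounded_operators sX qX sY qY"
  shows "module.subspace sY (range S)"
proof -
  interpret Vector_Spaces.linear sX sY S
    by (rule bounded_operators_linear[OF assms])
  show ?thesis by (rule subspace_image[OF vs1.subspace_UNIV])
qed

theorem theorem27: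
  fixes sX :: "'k::real_normed_field \<Rightarrow> 'a::ab_group_add \<Rightarrow> 'a"
    and sY :: "'k \<Rightarrow> 'b::ab_group_add \<Rightarrow> 'b"
    and qX :: "'a \<Rightarrow> real" and qY :: "'b \<Rightarrow> real" and CX CY :: real
    and T :: "'a \<Rightarrow> 'b" and n :: nat
  assumes "quasi_banach_space sX qX CX"
    and "quasi_banach_space sY qY CY"
    and "T \<in> bounded_operators sX qX sY qY"
    and "n \<ge> 1"
  shows "kolmogorov_number qX sY qY n T \<le> approximation_number sX qX sY qY n T"
proof -
  interpret X: quasi_banach_space sX qX CX by fact
  interpret Y: quasi_banach_space sY qY CY by fact
  note spaces = X.quasi_normed_space_axioms Y.quasi_normed_space_axioms
  let ?F = "{S \<in> bounded_operators sX qX sY qY. dim_less sY (range S) n}"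
  let ?\<U> = "{U. Y.subspace U \<and> dim_less sY U n}"
  let ?dev = "\<lambda>U. SUP x\<in>{x. qX x \<le> 1}. INF y\<in>U. qY (T x - y)"
  have "(\<lambda>x. 0) \<in> ?F"
    using zero_operator_bounded[OF spaces]
      dim_less_zero_subspace[OF Y.vector_space_axioms \<open>n \<ge> 1\<close>] by simp
  then have nonempty: "?F \<noteq> {}" by blast
  obtain M where M: "\<And>x. qX x \<le> 1 \<Longrightarrow> qY (T x) \<le> M"
    using bounded_operator_unit_ball_bound[OF spaces(1) assms(3)] by blast
  have "0 \<in> {x. qX x \<le> 1}" by (simp add: X.qnorm_zero)
  then have "0 \<le> ?dev U" if "U \<in> ?\<U>" for U
    using that M Y.subspace_0 by (intro Y.sup_distance_nonneg[where M = M]) auto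
  then have bdd: "bdd_below (?dev ` ?\<U>)" by (rule bdd_belowI2)
  show ?thesis
    unfolding kolmogorov_number_def approximation_number_def
  proof (rule cINF_mono[OF nonempty bdd])
    fix S assume "S \<in> ?F"
    then have S: "S \<in> bounded_operators sX qX sY qY" "range S \<in> ?\<U>"
      by (auto intro: bounded_operator_range_subspace)
    then show "\<exists>U\<in>?\<U>. ?dev U \<le> operator_qnorm qX qY (\<lambda>x. T x - S x)"
      using deviation_range_le_operator_qnorm[OF spaces assms(3) S(1)] by blast
  qed
qed

end
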